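(* Let $a>0$ and let $L_3=a\mathbb{Z}^3\cup a(\mathbb{Z}+\tfrac12)^3\cup W\cup\Lambda$. The Voronoi cell of the origin with respect to $L_3$ is the regular octahedron $$\{(x,y,z)\in\mathbb{R}^3:\ |x|+|y|+|z|\le \tfrac{5a}{16}\},$$ whose volume is $$V^{(3)}_\Gamma=\frac{125}{3072}a^3 .$$ The same holds, after translation, for every point of $a\mathbb{Z}^3\cup a(\mathbb{Z}+\tfrac12)^3$.
   Context: Fix $a>0$. $W\subset\mathbb{R}^3$ is the set of all points $a(u_1,u_2,u_3)$ such that $(u_1,u_2,u_3)$ is a permutation of a triple $(i,\ j+\tfrac12,\ k+\varepsilon)$ with $i,j,k\in\mathbb{Z}$ and $\varepsilon\in\{\tfrac14,\tfrac34\}$. $\Lambda=\{p+\tfrac{5a}{24}(s_1,s_2,s_3): p\in a\mathbb{Z}^3\cup a(\mathbb{Z}+\tfrac12)^3,\ s_i\in\{-1,1\}\}$. For a discrete set $P\subset\mathbb{R}^3$ and $p\in P$, the Voronoi cell of $p$ with respect to $P$ is $\{x\in\mathbb{R}^3: |x-p|\le|x-q|\ \text{for all } q\in P\}$. *)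

theory Defs
  imports "HOL-Analysis.Analysis"
begin

text \<open>Points of R^3 are modelled as real^3; components x$1, x$2, x$3.\<close>

definition int_lattice :: "real \<Rightarrow> (real^3) set" where
  "int_lattice a = {vector [a * of_int i, a * of_int j, a * of_int k] | i j k :: int. True}"

definition half_lattice :: "real \<Rightarrow> (real^3) set" where
  "half_lattice a = {vector [a * (of_int i + 1/2), a * (of_int j + 1/2), a * (of_int k + 1/2)]
                     | i j k :: int. True}"

text \<open>W: a*(u1,u2,u3) with (u1,u2,u3) a permutation of (i, j+1/2, k+eps), eps in {1/4,3/4}.\<close>
definition W_set :: "real \<Rightarrow> (real^3) set" where
  "W_set a = {x. \<exists>(i::int) (j::int) (k::int) (eps::real) (\<sigma>::3 \<Rightarrow> 3).
      eps \<in> {1/4, 3/4} \<and> \<sigma> permutes UNIV \<and>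
      x = (\<chi> m. a * ((vector [of_int i, of_int j + 1/2, of_int k + eps] :: real^3) $ \<sigma> m))}"

definition Lambda_set :: "real \<Rightarrow> (real^3) set" where
  "Lambda_set a = {p + (5 * a / 24) *\<^sub>R s | p s.
      p \<in> int_lattice a \<union> half_lattice a \<and> (\<forall>m. s $ m \<in> {-1, 1})}"

definition L3 :: "real \<Rightarrow> (real^3) set" where
  "L3 a = int_lattice a \<union> half_lattice a \<union> W_set a \<union> Lambda_set a"

definition voronoi_cell :: "(real^3) set \<Rightarrow> real^3 \<Rightarrow> (real^3) set" where
  "voronoi_cell P p = {x. \<forall>q\<in>P. norm (x - p) \<le> norm (x - q)}"

definition octahedron :: "real \<Rightarrow> (real^3) set" where
  "octahedron a = {x. \<bar>x $ 1\<bar> + \<bar>x $ 2\<bar> + \<bar>x $ 3\<bar> \<le> 5 * a / 16}"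

end

theory Submission
  imports Defs
begin

text \<open>
  A point x is at least as close to 0 as to q iff 2 (x \<bullet> q) \<le> q \<bullet> q. For x in the
  l1-ball of radius r we have x \<bullet> q \<le> r max |q_i|, so the octahedron (r = 5a/16) lies in
  the Voronoi cell of 0 as soon as (5a/8) |q_i| \<le> q \<bullet> q for every q \<in> L3 and every i.
  Writing q = a t, each coordinate t_i ranges over a union of cosets of \<int> (shifted by
  \<plusminus>5/24 for \<Lambda>), and on such a set u^2 - 5|u|/8 is smallest where |u| attains its
  least value \<rho>_i; this reduces the estimate to the single vector \<rho>. Conversely, the
  points (5a/24)(\<plusminus>1, \<plusminus>1, \<plusminus>1) of \<Lambda> cut the cell down to the octahedron. L3 is
  invariant under translation by the body-centred cubic lattice, which carries the
  cell of 0 to the cell of every lattice point, and the volume is that of eight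
  reflected copies of a scaled standard simplex.
\<close>

section \<open>Voronoi cells and the l1-ball\<close>

lemma norm_le_norm_diff_iff:
  fixes x q :: "'a::real_inner"
  shows "norm x \<le> norm (x - q) \<longleftrightarrow> 2 * (x \<bullet> q) \<le> q \<bullet> q"
  by (simp add: norm_le inner_diff_left inner_diff_right inner_commute)

definition clearance :: "real \<Rightarrow> real^'n \<Rightarrow> bool" where
  "clearance c q \<longleftrightarrow> (\<forall>i. c * \<bar>q$i\<bar> \<le> q \<bullet> q)"

lemma clearance_scaleR:
  assumes "clearance c t" "0 \<le> a"
  shows "clearance (a * c) (a *\<^sub>R t)"
  unfolding clearance_def
proof
  fix i
  have "a * c * \<bar>(a *\<^sub>R t) $ i\<bar> = (a * a) * (c * \<bar>t$i\<bar>)"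
    using assms(2) by (simp add: abs_mult)
  also have "\<dots> \<le> (a * a) * (t \<bullet> t)"
    using assms(1) by (intro mult_left_mono) (auto simp: clearance_def)
  finally show "a * c * \<bar>(a *\<^sub>R t) $ i\<bar> \<le> a *\<^sub>R t \<bullet> a *\<^sub>R t" by simp
qed

lemma norm_le_norm_diff_if_clearance:
  fixes x q :: "real^'n"
  assumes "0 < r" "(\<Sum>i\<in>UNIV. \<bar>x$i\<bar>) \<le> r" "clearance (2 * r) q"
  shows "norm x \<le> norm (x - q)"
proof -
  have "x \<bullet> q \<le> (\<Sum>i\<in>UNIV. \<bar>x$i\<bar> * \<bar>q$i\<bar>)"
    unfolding inner_vec_def by (intro sum_mono) (simp add: abs_mult[symmetric])
  then have "r * (2 * (x \<bullet> q)) \<le> (2 * r) * (\<Sum>i\<in>UNIV. \<bar>x$i\<bar> * \<bar>q$i\<bar>)"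
    using assms(1) by simp
  also have "\<dots> = (\<Sum>i\<in>UNIV. \<bar>x$i\<bar> * (2 * r * \<bar>q$i\<bar>))"
    by (simp add: sum_distrib_left ac_simps)
  also have "\<dots> \<le> (\<Sum>i\<in>UNIV. \<bar>x$i\<bar> * (q \<bullet> q))"
    using assms(3) by (intro sum_mono mult_left_mono) (auto simp: clearance_def)
  also have "\<dots> \<le> r * (q \<bullet> q)"
    using assms(2) by (simp add: sum_distrib_right[symmetric] mult_right_mono)
  finally show ?thesis
    using assms(1) by (simp add: norm_le_norm_diff_iff)
qed

lemma l1_norm_le_if_closer_than_sign_vector:
  fixes x :: "real^'n"
  defines "s \<equiv> \<chi> i. if 0 \<le> x$i then 1 else -1"
  assumes "0 < c" "norm x \<le> norm (x - c *\<^sub>R s)"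
  shows "2 * (\<Sum>i\<in>UNIV. \<bar>x$i\<bar>) \<le> c * CARD('n)"
proof -
  have xs: "x \<bullet> (c *\<^sub>R s) = c * (\<Sum>i\<in>UNIV. \<bar>x$i\<bar>)"
    by (auto simp: inner_vec_def s_def sum_distrib_left abs_if intro!: sum.cong)
  have "c *\<^sub>R s \<bullet> c *\<^sub>R s = (\<Sum>i::'n\<in>UNIV. c * c)"
    unfolding inner_vec_def by (rule sum.cong) (auto simp: s_def)
  then have ss: "c *\<^sub>R s \<bullet> c *\<^sub>R s = c * (c * CARD('n))"
    by simp
  have "2 * (x \<bullet> (c *\<^sub>R s)) \<le> c *\<^sub>R s \<bullet> c *\<^sub>R s"
    using assms(3) by (simp only: norm_le_norm_diff_iff)
  then have "c * (2 * (\<Sum>i\<in>UNIV. \<bar>x$i\<bar>)) \<le> c * (c * CARD('n))"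
    unfolding xs ss by linarith
  then show ?thesis
    using assms(2) by simp
qed

lemma voronoi_cell_translation:
  "voronoi_cell ((+) p ` P) (p + x) = (+) p ` voronoi_cell P x"
proof -
  have "y \<in> voronoi_cell ((+) p ` P) (p + x) \<longleftrightarrow> y - p \<in> voronoi_cell P x" for y
    by (simp add: voronoi_cell_def algebra_simps)
  moreover have "(+) p ` A = {y. y - p \<in> A}" for A :: "(real^3) set"
    by (auto simp: image_iff) (metis add.commute diff_add_cancel)
  ultimately show ?thesis
    by blast
qed

definition outside_gap :: "real \<Rightarrow> real \<Rightarrow> real \<Rightarrow> bool" where
  "outside_gap c \<rho> t \<longleftrightarrow> \<rho> \<le> \<bar>t\<bar> \<and> (\<bar>t\<bar> = \<rho> \<or> c - \<rho> \<le> \<bar>t\<bar>)"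

lemma outside_gap_bound:
  assumes "outside_gap c \<rho> t"
  shows "c * \<bar>t\<bar> - t * t \<le> c * \<rho> - \<rho> * \<rho>"
proof -
  have "0 \<le> (\<bar>t\<bar> - \<rho>) * (\<bar>t\<bar> + \<rho> - c)"
    using assms unfolding outside_gap_def by (auto intro: mult_nonneg_nonneg)
  then show ?thesis
    by (simp add: algebra_simps abs_mult_self_eq)
qed

lemma clearance_if_outside_gap:
  fixes t \<rho> :: "real^'n"
  assumes "\<And>i. 0 \<le> \<rho>$i" "\<And>i. outside_gap c (\<rho>$i) (t$i)" "clearance c \<rho>"
  shows "clearance c t"
  unfolding clearance_def
proof
  fix m
  have sq_le: "\<rho>$i * \<rho>$i \<le> t$i * t$i" for i
    using assms(1,2)[of i] unfolding outside_gap_def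
    by (metis abs_mult_self_eq mult_mono order_trans)
  have "t$m * t$m - \<rho>$m * \<rho>$m \<le> (\<Sum>i\<in>UNIV. t$i * t$i - \<rho>$i * \<rho>$i)"
    using sq_le by (intro member_le_sum) auto
  also have "\<dots> = t \<bullet> t - \<rho> \<bullet> \<rho>"
    by (simp add: inner_vec_def sum_subtractf)
  finally have "t$m * t$m - \<rho>$m * \<rho>$m \<le> t \<bullet> t - \<rho> \<bullet> \<rho>" .
  moreover have "c * \<rho>$m \<le> \<rho> \<bullet> \<rho>"
    using assms(1,3) by (simp add: clearance_def)
  ultimately show "c * \<bar>t$m\<bar> \<le> t \<bullet> t"
    using outside_gap_bound[OF assms(2)[of m]] by linarith
qed

lemma clearance_const:
  fixes r :: real
  assumes "0 \<le> r" "c * r \<le> CARD('n) * (r * r)"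
  shows "clearance c (\<chi> i::'n::finite. r)"
  using assms by (simp add: clearance_def inner_vec_def)

lemma clearance_permute:
  assumes "\<sigma> permutes UNIV" "clearance c \<rho>"
  shows "clearance c (\<chi> i. \<rho> $ \<sigma> i)"
proof -
  have "(\<chi> i. \<rho> $ \<sigma> i) \<bullet> (\<chi> i. \<rho> $ \<sigma> i) = \<rho> \<bullet> \<rho>"
    using sum.permute[OF assms(1), of "\<lambda>i. \<rho>$i * \<rho>$i"] by (simp add: inner_vec_def comp_def)
  then show ?thesis
    using assms(2) by (simp add: clearance_def)
qed

section \<open>Integer cosets\<close>

lemma Ints_offsetE:
  assumes "x - \<theta> \<in> \<int>"
  obtains n where "x = of_int n + \<theta>"
  using assms by (metis Ints_cases diff_add_cancel)

lemma Ints_add_offsets: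
  fixes x y :: real
  assumes "x - \<alpha> \<in> \<int>" "y - \<beta> \<in> \<int>" "\<alpha> + \<beta> - \<gamma> \<in> \<int>"
  shows "x + y - \<gamma> \<in> \<int>"
proof -
  have "(x - \<alpha>) + (y - \<beta>) + (\<alpha> + \<beta> - \<gamma>) \<in> \<int>"
    using assms by (intro Ints_add)
  then show ?thesis
    by (simp add: algebra_simps)
qed

lemma real_of_int_cases: "n = 0 \<or> n = -1 \<or> 1 \<le> real_of_int n \<or> real_of_int n \<le> -2"
  by linarith

lemma outside_gap_Ints:
  assumes "x \<in> \<int>"
  shows "outside_gap (5/8) 0 x"
proof -
  obtain n where "x = of_int n"
    using assms by (auto elim: Ints_cases)
  then show ?thesis
    using real_of_int_cases[of n] by (auto simp: outside_gap_def)
qed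

lemma outside_gap_half_Ints:
  assumes "x - 1/2 \<in> \<int>"
  shows "outside_gap (5/8) (1/2) x"
proof -
  obtain n where "x = of_int n + 1/2"
    using assms by (elim Ints_offsetE)
  then show ?thesis
    using real_of_int_cases[of n] by (auto simp: outside_gap_def)
qed

lemma outside_gap_quarter_Ints:
  assumes "x - 1/4 \<in> \<int> \<or> x - 3/4 \<in> \<int>"
  shows "outside_gap (5/8) (1/4) x"
proof -
  obtain n \<epsilon> where "x = of_int n + \<epsilon>" "\<epsilon> = 1/4 \<or> \<epsilon> = 3/4"
    using assms by (elim disjE Ints_offsetE) blast+
  then show ?thesis
    using real_of_int_cases[of n] by (auto simp: outside_gap_def)
qed

lemma outside_gap_Ints_shift:
  assumes "x \<in> \<int>" "s \<in> {-1, 1}"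
  shows "outside_gap (5/8) (5/24) (x + 5/24 * s)"
proof -
  obtain n where "x = of_int n"
    using assms by (auto elim: Ints_cases)
  then show ?thesis
    using assms(2) real_of_int_cases[of n] by (auto simp: outside_gap_def)
qed

lemma outside_gap_half_Ints_shift:
  assumes "x - 1/2 \<in> \<int>" "s \<in> {-1, 1}"
  shows "outside_gap (5/8) (7/24) (x + 5/24 * s)"
proof -
  obtain n where "x = of_int n + 1/2"
    using assms by (elim Ints_offsetE)
  then show ?thesis
    using assms(2) real_of_int_cases[of n] by (auto simp: outside_gap_def)
qed

section \<open>The point set L3 in lattice units\<close>

definition unit_bcc :: "(real^'n) set" where
  "unit_bcc = {t. (\<forall>i. t$i \<in> \<int>) \<or> (\<forall>i. t$i - 1/2 \<in> \<int>)}"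

definition W_class :: "3 \<Rightarrow> real set" where
  "W_class c = (if c = 1 then \<int> else if c = 2 then {x. x - 1/2 \<in> \<int>}
                else {x. x - 1/4 \<in> \<int> \<or> x - 3/4 \<in> \<int>})"

definition unit_W :: "(real^3) set" where
  "unit_W = {t. \<exists>\<sigma>. \<sigma> permutes UNIV \<and> (\<forall>i. t$i \<in> W_class (\<sigma> i))}"

definition unit_Lambda :: "(real^'n) set" where
  "unit_Lambda = {u + (5/24) *\<^sub>R s | u s. u \<in> unit_bcc \<and> (\<forall>i. s$i \<in> {-1, 1})}"

lemma cubic_coset_eq:
  "{vector [a * (of_int i + \<theta>), a * (of_int j + \<theta>), a * (of_int k + \<theta>)] | i j k :: int. True}
     = (*\<^sub>R) a ` {t :: real^3. \<forall>m. t$m - \<theta> \<in> \<int>}" (is "?C = _")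
proof (intro set_eqI iffI)
  fix x :: "real^3"
  assume "x \<in> ?C"
  then obtain i j k :: int
    where x: "x = vector [a * (of_int i + \<theta>), a * (of_int j + \<theta>), a * (of_int k + \<theta>)]"
    by blast
  show "x \<in> (*\<^sub>R) a ` {t. \<forall>m. t$m - \<theta> \<in> \<int>}"
    by (rule image_eqI[of _ _ "vector [of_int i + \<theta>, of_int j + \<theta>, of_int k + \<theta>]"])
       (simp_all add: x vec_eq_iff forall_3)
next
  fix x :: "real^3"
  assume "x \<in> (*\<^sub>R) a ` {t :: real^3. \<forall>m. t$m - \<theta> \<in> \<int>}"
  then obtain t :: "real^3" where x: "x = a *\<^sub>R t" and t: "\<forall>m. t$m - \<theta> \<in> \<int>"
    by blast
  obtain i j k where "t$1 - \<theta> = of_int i" "t$2 - \<theta> = of_int j" "t$3 - \<theta> = of_int k"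
    using t by (meson Ints_cases)
  then have "x = vector [a * (of_int i + \<theta>), a * (of_int j + \<theta>), a * (of_int k + \<theta>)]"
    by (simp add: x vec_eq_iff forall_3 algebra_simps)
  then show "x \<in> ?C"
    by blast
qed

lemma bcc_eq: "int_lattice a \<union> half_lattice a = (*\<^sub>R) a ` unit_bcc"
  using cubic_coset_eq[of a 0] cubic_coset_eq[of a "1/2"]
  by (auto simp: int_lattice_def half_lattice_def unit_bcc_def)

lemma W_classes_iff:
  "(\<forall>c. v$c \<in> W_class c) \<longleftrightarrow>
     (\<exists>i j k \<epsilon>. \<epsilon> \<in> {1/4, 3/4} \<and> v = vector [of_int i, of_int j + 1/2, of_int k + \<epsilon>])"
  (is "_ \<longleftrightarrow> ?W")
proof
  assume v: "\<forall>c. v$c \<in> W_class c"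
  obtain i where "v$1 = of_int i"
    using v[rule_format, of 1] by (auto simp: W_class_def elim: Ints_cases)
  moreover obtain j where "v$2 = of_int j + 1/2"
    using v[rule_format, of 2] by (auto simp: W_class_def elim!: Ints_offsetE)
  moreover obtain k \<epsilon> where "v$3 = of_int k + \<epsilon>" "\<epsilon> \<in> {1/4, 3/4}"
    using v[rule_format, of 3] by (auto simp: W_class_def elim!: Ints_offsetE)
  ultimately show ?W
    by (auto simp: vec_eq_iff forall_3)
next
  assume ?W
  then obtain i j k \<epsilon>
    where "\<epsilon> = 1/4 \<or> \<epsilon> = 3/4" "v = vector [of_int i, of_int j + 1/2, of_int k + \<epsilon>]"
    by auto
  then show "\<forall>c. v$c \<in> W_class c"
    by (elim disjE; hypsubst; simp add: forall_3 W_class_def)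
qed

lemma W_set_eq: "W_set a = (*\<^sub>R) a ` unit_W"
proof (intro set_eqI iffI)
  fix x
  assume "x \<in> W_set a"
  then obtain v :: "real^3" and \<sigma> where v: "\<forall>c. v$c \<in> W_class c" and \<sigma>: "\<sigma> permutes UNIV"
    and x: "x = (\<chi> m. a * v $ \<sigma> m)"
    unfolding W_set_def W_classes_iff by blast
  have "(\<chi> m. v $ \<sigma> m) \<in> unit_W"
    using v \<sigma> unfolding unit_W_def by auto
  moreover have "x = a *\<^sub>R (\<chi> m. v $ \<sigma> m)"
    by (simp add: x vec_eq_iff)
  ultimately show "x \<in> (*\<^sub>R) a ` unit_W"
    by blast
next
  fix x
  assume "x \<in> (*\<^sub>R) a ` unit_W"
  then obtain t \<sigma> where x: "x = a *\<^sub>R t" and \<sigma>: "\<sigma> permutes UNIV"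
    and t: "\<forall>m. t$m \<in> W_class (\<sigma> m)"
    unfolding unit_W_def by blast
  define v where "v = (\<chi> c. t $ inv \<sigma> c)"
  have "v$c \<in> W_class c" for c
    using t[rule_format, of "inv \<sigma> c"] by (simp add: v_def permutes_inverses(1)[OF \<sigma>])
  then obtain i j k \<epsilon> where "\<epsilon> \<in> {1/4, 3/4}" "v = vector [of_int i, of_int j + 1/2, of_int k + \<epsilon>]"
    using W_classes_iff by blast
  moreover have "x = (\<chi> m. a * v $ \<sigma> m)"
    by (simp add: x v_def vec_eq_iff permutes_inverses(2)[OF \<sigma>])
  ultimately show "x \<in> W_set a"
    using \<sigma> unfolding W_set_def by blast
qed

lemma Lambda_set_eq: "Lambda_set a = (*\<^sub>R) a ` unit_Lambda"
proof (intro set_eqI iffI)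
  fix x :: "real^3"
  assume "x \<in> Lambda_set a"
  then obtain u s where u: "u \<in> unit_bcc" and s: "\<forall>i. s$i \<in> {-1, 1}"
    and x: "x = a *\<^sub>R u + (5 * a / 24) *\<^sub>R s"
    unfolding Lambda_set_def bcc_eq by blast
  have "x = a *\<^sub>R (u + (5/24) *\<^sub>R s)"
    by (simp add: x algebra_simps)
  moreover have "u + (5/24) *\<^sub>R s \<in> unit_Lambda"
    using u s unfolding unit_Lambda_def by blast
  ultimately show "x \<in> (*\<^sub>R) a ` unit_Lambda"
    by blast
next
  fix x :: "real^3"
  assume "x \<in> (*\<^sub>R) a ` unit_Lambda"
  then obtain u s where u: "u \<in> unit_bcc" and s: "\<forall>i. s$i \<in> {-1, 1}"
    and x: "x = a *\<^sub>R (u + (5/24) *\<^sub>R s)"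
    unfolding unit_Lambda_def by blast
  have "x = a *\<^sub>R u + (5 * a / 24) *\<^sub>R s"
    by (simp add: x algebra_simps)
  moreover have "a *\<^sub>R u \<in> int_lattice a \<union> half_lattice a"
    using u unfolding bcc_eq by blast
  ultimately show "x \<in> Lambda_set a"
    using s unfolding Lambda_set_def by blast
qed

definition unit_L3 :: "(real^3) set" where
  "unit_L3 = unit_bcc \<union> unit_W \<union> unit_Lambda"

lemma L3_eq: "L3 a = (*\<^sub>R) a ` unit_L3"
  by (simp add: L3_def unit_L3_def bcc_eq W_set_eq Lambda_set_eq image_Un)

lemma clearance_unit_bcc:
  fixes t :: "real^3"
  assumes "t \<in> unit_bcc"
  shows "clearance (5/8) t"
proof -
  consider "\<forall>i. t$i \<in> \<int>" | "\<forall>i. t$i - 1/2 \<in> \<int>"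
    using assms unfolding unit_bcc_def by blast
  then show ?thesis
  proof cases
    case 1
    then show ?thesis
      by (intro clearance_if_outside_gap[where \<rho> = "\<chi> i. 0" and t = t] clearance_const)
         (auto intro: outside_gap_Ints)
  next
    case 2
    then show ?thesis
      by (intro clearance_if_outside_gap[where \<rho> = "\<chi> i. 1/2" and t = t] clearance_const)
         (auto intro: outside_gap_half_Ints)
  qed
qed

lemma clearance_unit_W:
  assumes "t \<in> unit_W"
  shows "clearance (5/8) t"
proof -
  obtain \<sigma> where \<sigma>: "\<sigma> permutes UNIV" and t: "\<forall>i. t$i \<in> W_class (\<sigma> i)"
    using assms unfolding unit_W_def by blast
  define \<rho> :: "real^3" where "\<rho> = vector [0, 1/2, 1/4]"
  have "clearance (5/8) \<rho>"
    by (simp add: clearance_def inner_vec_def sum_3 forall_3 \<rho>_def)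
  then have "clearance (5/8) (\<chi> i. \<rho> $ \<sigma> i)"
    by (rule clearance_permute[OF \<sigma>])
  moreover have "outside_gap (5/8) (\<rho> $ \<sigma> i) (t$i)" for i
    using t[rule_format, of i] exhaust_3[of "\<sigma> i"]
    by (auto simp: W_class_def \<rho>_def intro: outside_gap_Ints outside_gap_half_Ints outside_gap_quarter_Ints)
  moreover have "0 \<le> \<rho> $ c" for c
    using exhaust_3[of c] by (auto simp: \<rho>_def)
  ultimately show ?thesis
    by (intro clearance_if_outside_gap[where \<rho> = "\<chi> i. \<rho> $ \<sigma> i" and t = t]) auto
qed

lemma clearance_unit_Lambda:
  fixes t :: "real^3"
  assumes "t \<in> unit_Lambda"
  shows "clearance (5/8) t"
proof -
  obtain u s where u: "u \<in> unit_bcc" and s: "\<forall>i. s$i \<in> {-1, 1}" and t: "t = u + (5/24) *\<^sub>R s"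
    using assms unfolding unit_Lambda_def by blast
  have t_i: "t$i = u$i + 5/24 * s$i" for i
    by (simp add: t)
  consider "\<forall>i. u$i \<in> \<int>" | "\<forall>i. u$i - 1/2 \<in> \<int>"
    using u unfolding unit_bcc_def by blast
  then show ?thesis
  proof cases
    case 1
    then have "outside_gap (5/8) (5/24) (t$i)" for i
      unfolding t_i using s by (intro outside_gap_Ints_shift) auto
    then show ?thesis
      by (intro clearance_if_outside_gap[where \<rho> = "\<chi> i. 5/24" and t = t] clearance_const) auto
  next
    case 2
    then have "outside_gap (5/8) (7/24) (t$i)" for i
      unfolding t_i using s by (intro outside_gap_half_Ints_shift) auto
    then show ?thesis
      by (intro clearance_if_outside_gap[where \<rho> = "\<chi> i. 7/24" and t = t] clearance_const) auto
  qed
qed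

lemma clearance_unit_L3: "t \<in> unit_L3 \<Longrightarrow> clearance (5/8) t"
  unfolding unit_L3_def using clearance_unit_bcc clearance_unit_W clearance_unit_Lambda by blast

section \<open>Translation invariance\<close>

lemma unit_bcc_add:
  assumes "u \<in> unit_bcc" "v \<in> unit_bcc"
  shows "u + v \<in> unit_bcc"
  using assms Ints_add_offsets[of "u$i" 0 "v$i" 0 0 for i]
    Ints_add_offsets[of "u$i" "1/2" "v$i" 0 "1/2" for i] Ints_add_offsets[of "u$i" 0 "v$i" "1/2" "1/2" for i]
    Ints_add_offsets[of "u$i" "1/2" "v$i" "1/2" 0 for i]
  by (auto simp: unit_bcc_def)

lemma unit_bcc_uminus:
  assumes "u \<in> unit_bcc"
  shows "- u \<in> unit_bcc"
proof -
  have "- x - 1/2 \<in> \<int>" if "x - 1/2 \<in> \<int>" for x :: real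
  proof -
    have "- (x - 1/2) - 1 \<in> \<int>"
      by (rule Ints_diff[OF Ints_minus[OF that] Ints_1])
    moreover have "- (x - 1/2) - 1 = - x - 1/2"
      by simp
    ultimately show ?thesis
      by argo
  qed
  then show ?thesis
    using assms by (auto simp: unit_bcc_def)
qed

lemma W_class_add_Ints:
  assumes "x \<in> W_class c" "y \<in> \<int>"
  shows "x + y \<in> W_class c"
  using assms Ints_add_offsets[of x 0 y 0 0] Ints_add_offsets[of x "1/2" y 0 "1/2"]
    Ints_add_offsets[of x "1/4" y 0 "1/4"] Ints_add_offsets[of x "3/4" y 0 "3/4"]
  by (auto simp: W_class_def)

lemma W_class_add_half_Ints:
  assumes "x \<in> W_class c" "y - 1/2 \<in> \<int>"
  shows "x + y \<in> W_class (Transposition.transpose 1 2 c)"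
  using assms exhaust_3[of c] Ints_add_offsets[of x 0 y "1/2" "1/2"] Ints_add_offsets[of x "1/2" y "1/2" 0]
    Ints_add_offsets[of x "1/4" y "1/2" "3/4"] Ints_add_offsets[of x "3/4" y "1/2" "1/4"]
  by (auto simp: W_class_def Transposition.transpose_def)

lemma unit_W_add:
  assumes "t \<in> unit_W" "u \<in> unit_bcc"
  shows "t + u \<in> unit_W"
proof -
  obtain \<sigma> where \<sigma>: "\<sigma> permutes UNIV" and t: "\<forall>i. t$i \<in> W_class (\<sigma> i)"
    using assms(1) unfolding unit_W_def by blast
  consider "\<forall>i. u$i \<in> \<int>" | "\<forall>i. u$i - 1/2 \<in> \<int>"
    using assms(2) unfolding unit_bcc_def by blast
  then show ?thesis
  proof cases
    case 1
    then show ?thesis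
      using \<sigma> t W_class_add_Ints unfolding unit_W_def by auto
  next
    case 2
    have "Transposition.transpose 1 2 \<circ> \<sigma> permutes UNIV"
      by (intro permutes_compose[OF \<sigma>] permutes_swap_id) auto
    then show ?thesis
      using 2 t W_class_add_half_Ints unfolding unit_W_def
      by (auto intro!: exI[of _ "Transposition.transpose 1 2 \<circ> \<sigma>"])
  qed
qed

lemma unit_Lambda_add:
  assumes "t \<in> unit_Lambda" "u \<in> unit_bcc"
  shows "t + u \<in> unit_Lambda"
proof -
  obtain v s where "v \<in> unit_bcc" "\<forall>i. s$i \<in> {-1, 1}" "t = v + (5/24) *\<^sub>R s"
    using assms(1) unfolding unit_Lambda_def by blast
  moreover from this have "t + u = (v + u) + (5/24) *\<^sub>R s"
    by (simp add: algebra_simps)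
  ultimately show ?thesis
    using unit_bcc_add[OF _ assms(2)] unfolding unit_Lambda_def by blast
qed

lemma unit_L3_add: "t \<in> unit_L3 \<Longrightarrow> u \<in> unit_bcc \<Longrightarrow> t + u \<in> unit_L3"
  unfolding unit_L3_def using unit_bcc_add unit_W_add unit_Lambda_add by blast

lemma unit_L3_translation:
  assumes "u \<in> unit_bcc"
  shows "(+) u ` unit_L3 = unit_L3"
proof (intro equalityI subsetI)
  fix t
  assume "t \<in> (+) u ` unit_L3"
  then show "t \<in> unit_L3"
    using unit_L3_add[OF _ assms] by (auto simp: add.commute)
next
  fix t
  assume "t \<in> unit_L3"
  then have "t + - u \<in> unit_L3"
    using unit_L3_add unit_bcc_uminus[OF assms] by blast
  then show "t \<in> (+) u ` unit_L3"
    by (rule rev_image_eqI) simp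
qed

lemma L3_translation:
  assumes "p \<in> int_lattice a \<union> half_lattice a"
  shows "(+) p ` L3 a = L3 a"
proof -
  obtain u where u: "u \<in> unit_bcc" and p: "p = a *\<^sub>R u"
    using assms unfolding bcc_eq by blast
  have "(+) p ` L3 a = (*\<^sub>R) a ` ((+) u ` unit_L3)"
    unfolding L3_eq p image_image by (simp add: scaleR_right_distrib)
  then show ?thesis
    unfolding unit_L3_translation[OF u] L3_eq .
qed

section \<open>Volume of the l1-ball\<close>

definition reflect_coord :: "'n \<Rightarrow> real^'n \<Rightarrow> real^'n" where
  "reflect_coord k x = (\<chi> i. if i = k then - x$i else x$i)"

lemma orthogonal_transformation_reflect_coord: "orthogonal_transformation (reflect_coord k)"
  unfolding orthogonal_transformation_def
proof
  show "linear (reflect_coord k)"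
    by (rule linearI) (auto simp: vec_eq_iff reflect_coord_def)
  show "\<forall>v w. reflect_coord k v \<bullet> reflect_coord k w = v \<bullet> w"
    by (auto simp: inner_vec_def reflect_coord_def intro!: sum.cong)
qed

lemma measure_eq_twice_half_if_reflection_invariant:
  fixes S :: "(real^'n::{finite,wellorder}) set"
  assumes S: "compact S" and refl: "\<And>x. x \<in> S \<Longrightarrow> reflect_coord k x \<in> S"
  shows "measure lebesgue S = 2 * measure lebesgue (S \<inter> {x. 0 \<le> x$k})"
proof -
  define P where "P = S \<inter> {x. 0 \<le> x$k}"
  define N where "N = reflect_coord k ` P"
  have "P \<in> lmeasurable"
    unfolding P_def by (intro lmeasurable_compact compact_Int_closed S closed_halfspace_component_ge_cart)
  then have N: "N \<in> lmeasurable" "measure lebesgue N = measure lebesgue P"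
    unfolding N_def
    by (simp_all add: measurable_orthogonal_image measure_orthogonal_image
        orthogonal_transformation_reflect_coord)
  have "S \<subseteq> P \<union> N"
  proof
    fix x
    assume x: "x \<in> S"
    show "x \<in> P \<union> N"
    proof (cases "0 \<le> x$k")
      case True
      then show ?thesis
        using x by (simp add: P_def)
    next
      case False
      then have "reflect_coord k x \<in> P"
        using refl[OF x] by (simp add: P_def reflect_coord_def)
      moreover have "x = reflect_coord k (reflect_coord k x)"
        by (simp add: vec_eq_iff reflect_coord_def)
      ultimately show ?thesis
        unfolding N_def by blast
    qed
  qed
  moreover have "P \<union> N \<subseteq> S"
    using refl unfolding P_def N_def by auto
  ultimately have "S = P \<union> N"
    by blast
  have "negligible (P \<inter> N)"
    by (rule negligible_subset[OF negligible_standard_hyperplane_cart[of k]])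
       (auto simp: P_def N_def reflect_coord_def)
  then have "measure lebesgue (P \<inter> N) = 0"
    by (rule negligible_imp_measure0)
  then show ?thesis
    using measure_Un3[OF \<open>P \<in> lmeasurable\<close> N(1)] N(2) \<open>S = P \<union> N\<close>
    unfolding P_def by simp
qed

lemma std_simplex_cart:
  "convex hull (insert 0 Basis) = {x::real^'n. (\<forall>i. 0 \<le> x$i) \<and> (\<Sum>i\<in>UNIV. x$i) \<le> 1}"
proof -
  have B: "(Basis :: (real^'n) set) = range (\<lambda>i. axis i 1)"
    by (auto simp: Basis_vec_def)
  have "(\<Sum>b\<in>Basis. x \<bullet> b) = (\<Sum>i\<in>UNIV. x$i)" for x :: "real^'n"
    unfolding B by (subst sum.reindex) (auto simp: inj_on_def axis_eq_axis inner_axis)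
  then show ?thesis
    unfolding std_simplex by (auto simp: B inner_axis)
qed

lemma measure_l1_ball_orthant:
  fixes r :: real
  defines "B \<equiv> {x::real^'n::{finite,wellorder}. (\<Sum>i\<in>UNIV. \<bar>x$i\<bar>) \<le> r}"
  shows "measure lebesgue B = 2 ^ card K * measure lebesgue (B \<inter> (\<Inter>i\<in>K. {x. 0 \<le> x$i}))"
proof (induction K rule: finite_induct[OF finite])
  case 1
  show ?case
    by simp
next
  case (2 k K)
  have "closed B"
    unfolding B_def by (intro closed_Collect_le continuous_intros)
  moreover have "bounded B"
    unfolding B_def bounded_iff using norm_le_l1_cart by (blast intro: order_trans)
  ultimately have "compact (B \<inter> (\<Inter>i\<in>K. {x. 0 \<le> x$i}))"
    by (intro compact_Int_closed closed_INT ballI closed_halfspace_component_ge_cart)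
       (simp add: compact_eq_bounded_closed)
  moreover have "reflect_coord k x \<in> B \<inter> (\<Inter>i\<in>K. {x. 0 \<le> x$i})"
    if "x \<in> B \<inter> (\<Inter>i\<in>K. {x. 0 \<le> x$i})" for x
  proof -
    have "\<bar>reflect_coord k x $ i\<bar> = \<bar>x$i\<bar>" for i
      by (simp add: reflect_coord_def)
    then show ?thesis
      using that \<open>k \<notin> K\<close> by (auto simp: B_def) (auto simp: reflect_coord_def)
  qed
  ultimately have "measure lebesgue (B \<inter> (\<Inter>i\<in>K. {x. 0 \<le> x$i}))
      = 2 * measure lebesgue (B \<inter> (\<Inter>i\<in>insert k K. {x. 0 \<le> x$i}))"
    by (subst measure_eq_twice_half_if_reflection_invariant[where k = k]) (auto simp: Int_ac)
  then show ?case
    using 2 by simp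
qed

lemma measure_l1_ball_cart:
  assumes "0 < r"
  shows "measure lebesgue {x::real^'n::{finite,wellorder}. (\<Sum>i\<in>UNIV. \<bar>x$i\<bar>) \<le> r}
           = (2 * r) ^ CARD('n) / fact CARD('n)"
proof -
  define B where "B = {x::real^'n::{finite,wellorder}. (\<Sum>i\<in>UNIV. \<bar>x$i\<bar>) \<le> r}"
  define T where "T = (convex hull (insert 0 Basis) :: (real^'n::{finite,wellorder}) set)"
  have "B \<inter> (\<Inter>i. {x. 0 \<le> x$i}) = (*\<^sub>R) r ` T"
  proof (intro equalityI subsetI)
    fix x
    assume "x \<in> B \<inter> (\<Inter>i. {x. 0 \<le> x$i})"
    then have "(1/r) *\<^sub>R x \<in> T"
      using assms by (auto simp: B_def T_def std_simplex_cart sum_divide_distrib[symmetric])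
    moreover have "x = r *\<^sub>R ((1/r) *\<^sub>R x)"
      using assms by simp
    ultimately show "x \<in> (*\<^sub>R) r ` T"
      by blast
  next
    fix y
    assume "y \<in> (*\<^sub>R) r ` T"
    then obtain x where "x \<in> T" "y = r *\<^sub>R x"
      by auto
    then show "y \<in> B \<inter> (\<Inter>i. {x. 0 \<le> x$i})"
      using assms by (auto simp: B_def T_def std_simplex_cart sum_distrib_left[symmetric] mult_left_le)
  qed
  then have "measure lebesgue (B \<inter> (\<Inter>i. {x. 0 \<le> x$i})) = r ^ CARD('n) * measure lebesgue T"
    using assms measure_lebesgue_affine[of r 0 T] by simp
  also have "measure lebesgue T = measure lborel T"
    unfolding T_def
    by (intro measure_completion) (simp add: borel_compact finite_imp_compact_convex_hull)
  also have "\<dots> = 1 / fact CARD('n)"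
    unfolding T_def by (simp add: content_std_simplex)
  finally show ?thesis
    using measure_l1_ball_orthant[of r "UNIV :: 'n set"] by (simp add: B_def power_mult_distrib)
qed

section \<open>The Voronoi cell of L3\<close>

lemma octahedron_eq_l1_ball: "octahedron a = {x. (\<Sum>i\<in>UNIV. \<bar>x$i\<bar>) \<le> 5 * a / 16}"
  by (simp add: octahedron_def sum_3)

lemma voronoi_cell_L3_origin:
  assumes "0 < a"
  shows "voronoi_cell (L3 a) 0 = octahedron a"
proof (intro equalityI subsetI)
  fix x
  assume "x \<in> octahedron a"
  then have l1: "(\<Sum>i\<in>UNIV. \<bar>x$i\<bar>) \<le> 5 * a / 16"
    by (simp add: octahedron_eq_l1_ball)
  have "norm x \<le> norm (x - q)" if q: "q \<in> L3 a" for q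
  proof -
    obtain t where "t \<in> unit_L3" "q = a *\<^sub>R t"
      using q unfolding L3_eq by blast
    then have "clearance (2 * (5 * a / 16)) q"
      using clearance_scaleR[OF clearance_unit_L3, of t a] assms by (simp add: ac_simps)
    then show ?thesis
      using l1 assms norm_le_norm_diff_if_clearance[of "5 * a / 16" x q] by simp
  qed
  then show "x \<in> voronoi_cell (L3 a) 0"
    by (simp add: voronoi_cell_def)
next
  fix x
  assume x: "x \<in> voronoi_cell (L3 a) 0"
  define s :: "real^3" where "s = (\<chi> i. if 0 \<le> x$i then 1 else -1)"
  have "0 \<in> unit_bcc" "\<forall>i. s$i \<in> {-1, 1}"
    by (simp_all add: unit_bcc_def s_def)
  then have "0 + (5/24) *\<^sub>R s \<in> unit_Lambda"
    unfolding unit_Lambda_def by blast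
  then have "(5 * a / 24) *\<^sub>R s \<in> L3 a"
    unfolding L3_eq unit_L3_def by (intro rev_image_eqI[of "(5/24) *\<^sub>R s"]) auto
  then have "norm x \<le> norm (x - (5 * a / 24) *\<^sub>R s)"
    using x by (simp add: voronoi_cell_def)
  then have "2 * (\<Sum>i\<in>UNIV. \<bar>x$i\<bar>) \<le> 5 * a / 24 * CARD(3)"
    using assms unfolding s_def by (intro l1_norm_le_if_closer_than_sign_vector) auto
  then show "x \<in> octahedron a"
    by (simp add: octahedron_eq_l1_ball)
qed

theorem mainTheorem6:
  fixes a :: real
  assumes "a > 0"
  shows "voronoi_cell (L3 a) 0 = octahedron a
       \<and> measure lebesgue (octahedron a) = 125 / 3072 * a ^ 3
       \<and> (\<forall>p \<in> int_lattice a \<union> half_lattice a.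
             voronoi_cell (L3 a) p = (\<lambda>x. p + x) ` octahedron a)"
proof (intro conjI ballI)
  show cell: "voronoi_cell (L3 a) 0 = octahedron a"
    using assms by (rule voronoi_cell_L3_origin)
  show "measure lebesgue (octahedron a) = 125 / 3072 * a ^ 3"
    using assms measure_l1_ball_cart[of "5 * a / 16", where 'n = 3]
    by (simp add: octahedron_eq_l1_ball power_divide fact_numeral)
  fix p
  assume "p \<in> int_lattice a \<union> half_lattice a"
  then have "voronoi_cell (L3 a) p = voronoi_cell ((+) p ` L3 a) (p + 0)"
    by (simp add: L3_translation)
  also have "\<dots> = (\<lambda>x. p + x) ` octahedron a"
    unfolding voronoi_cell_translation cell ..
  finally show "voronoi_cell (L3 a) p = (\<lambda>x. p + x) ` octahedron a" .
qed

end
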